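(* Let $a>b>0$ and $v=(a-b)/(a+b)\in(0,1)$. Let $p\in(0,\infty)$, $q\in(0,\pi/2)$, $r\in(0,\log(2+\sqrt{3}))$ and $s\in(0,\pi/3)$ be the parameters such that $1/\cosh(p)=\cos(q)=1-v^2$ and $\cosh(r)=\sec(s)=1+v^2$. Then $$N_{AH}(a,b)=\frac{1}{2}A(a,b)\left[1+\frac{2p}{\sinh(2p)}\right],$$ $$N_{HA}(a,b)=\frac{1}{2}A(a,b)\left[\cos(q)+\frac{q}{\sin(q)}\right],$$ $$N_{CA}(a,b)=\frac{1}{2}A(a,b)\left[\cosh(r)+\frac{r}{\sinh(r)}\right],$$ $$N_{AC}(a,b)=\frac{1}{2}A(a,b)\left[1+\frac{2s}{\sin(2s)}\right],$$ and $$H(a,b)<N_{AH}(a,b)<N_{HA}(a,b)<A(a,b)<N_{CA}(a,b)<N_{AC}(a,b)<C(a,b).$$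
   Context: For $a,b>0$: $H(a,b)=\frac{2ab}{a+b}$ (harmonic mean), $A(a,b)=\frac{a+b}{2}$ (arithmetic mean), $C(a,b)=\frac{a^2+b^2}{a+b}$ (contraharmonic mean). For $x,y>0$ with $x\neq y$, the Schwab-Borchardt mean is $$SB(x,y)=\begin{cases}\dfrac{\sqrt{y^2-x^2}}{\cos^{-1}(x/y)}, & x<y,\\[2mm] \dfrac{\sqrt{x^2-y^2}}{\cosh^{-1}(x/y)}, & x>y,\end{cases}$$ where $\cos^{-1}$ is the inverse cosine and $\cosh^{-1}(x)=\log(x+\sqrt{x^2-1})$. The Neuman mean is $$N(x,y)=\frac12\left[x+\frac{y^2}{SB(x,y)}\right].$$ For $a\ne b$: $N_{AH}(a,b)=N(A(a,b),H(a,b))$, $N_{HA}(a,b)=N(H(a,b),A(a,b))$, $N_{CA}(a,b)=N(C(a,b),A(a,b))$, $N_{AC}(a,b)=N(A(a,b),C(a,b))$. *)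

theory Defs
  imports Complex_Main
begin

definition H_mean :: "real \<Rightarrow> real \<Rightarrow> real" where
  "H_mean a b = 2 * a * b / (a + b)"

definition A_mean :: "real \<Rightarrow> real \<Rightarrow> real" where
  "A_mean a b = (a + b) / 2"

definition C_mean :: "real \<Rightarrow> real \<Rightarrow> real" where
  "C_mean a b = (a\<^sup>2 + b\<^sup>2) / (a + b)"

text \<open>The Schwab-Borchardt mean is meant for positive \<open>x \<noteq> y\<close> only. In the second
  branch \<open>x / y > 1\<close>, where \<open>arcosh z = ln (z + sqrt (z\<^sup>2 - 1))\<close> (lemma \<open>arcosh_real_def\<close>).\<close>

definition SB_mean :: "real \<Rightarrow> real \<Rightarrow> real" where
  "SB_mean x y =
     (if x < y then sqrt (y\<^sup>2 - x\<^sup>2) / arccos (x / y)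
      else if x > y then sqrt (x\<^sup>2 - y\<^sup>2) / arcosh (x / y)
      else undefined)"

definition N_mean :: "real \<Rightarrow> real \<Rightarrow> real" where
  "N_mean x y = (1 / 2) * (x + y\<^sup>2 / SB_mean x y)"

definition N_AH :: "real \<Rightarrow> real \<Rightarrow> real" where
  "N_AH a b = N_mean (A_mean a b) (H_mean a b)"

definition N_HA :: "real \<Rightarrow> real \<Rightarrow> real" where
  "N_HA a b = N_mean (H_mean a b) (A_mean a b)"

definition N_CA :: "real \<Rightarrow> real \<Rightarrow> real" where
  "N_CA a b = N_mean (C_mean a b) (A_mean a b)"

definition N_AC :: "real \<Rightarrow> real \<Rightarrow> real" where
  "N_AC a b = N_mean (A_mean a b) (C_mean a b)"

end

theory Submission
  imports Defs
begin

text \<open>Scaling out the second argument turns the Neuman mean into an expression in the angle, so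
  that every inequality of the chain compares a function of one parameter with its value at \<open>0\<close>.
  The two inequalities between Neuman means relate a circular angle \<open>q\<close> and a hyperbolic
  one \<open>p\<close> with \<open>cos q * cosh p = 1\<close>; there \<open>q = arctan (sinh p)\<close> (the Gudermannian of \<open>p\<close>),
  and both reduce to the same inequality \<open>gudermannian_gt\<close>.\<close>

text \<open>Mean value theorem. Positivity of \<open>f'\<close> is asked only strictly inside the
  interval, because in every application \<open>f'\<close> vanishes at 0.\<close>

lemma pos_if_zero_and_deriv_pos:
  fixes f f' :: "real \<Rightarrow> real"
  assumes "0 < x" and "f 0 = 0"
    and deriv: "\<And>t. (f has_real_derivative f' t) (at t)"
    and pos: "\<And>t. 0 < t \<Longrightarrow> t < x \<Longrightarrow> 0 < f' t"
  shows "0 < f x"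
proof -
  obtain z where "0 < z" "z < x" "f x - f 0 = (x - 0) * f' z"
    using MVT2[OF \<open>0 < x\<close>, of f f'] deriv by blast
  then show ?thesis
    using pos[of z] assms(1,2) by simp
qed

text \<open>\<open>cosh_plus_gt_2\<close> with its denominator cleared. The derivative of the
  difference factors because \<open>cosh^2 + sinh^2 + 1 = 2 cosh^2\<close>;
  \<open>sin_cos_less\<close> is the circular analogue.\<close>

lemma sinh_cosh_gt:
  fixes x :: real
  assumes "0 < x"
  shows "2 * sinh x < sinh x * cosh x + x"
proof -
  have "0 < sinh x * cosh x + x - 2 * sinh x"
  proof (rule pos_if_zero_and_deriv_pos[OF assms])
    show "((\<lambda>t. sinh t * cosh t + t - 2 * sinh t) has_real_derivative
        2 * cosh t * (cosh t - 1)) (at t)" for t :: real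
      by (auto intro!: derivative_eq_intros simp: algebra_simps sinh_square_eq simp flip: power2_eq_square)
    show "0 < 2 * cosh t * (cosh t - 1)" if "0 < t" for t :: real
      using that cosh_real_strict_mono[of 0 t] by simp
  qed simp
  then show ?thesis by simp
qed

lemma sin_cos_less:
  fixes x :: real
  assumes "0 < x" "x < pi / 2"
  shows "sin x * cos x + x < 2 * sin x"
proof -
  have "0 < 2 * sin x - sin x * cos x - x"
  proof (rule pos_if_zero_and_deriv_pos[OF assms(1)])
    show "((\<lambda>t. 2 * sin t - sin t * cos t - t) has_real_derivative
        2 * cos t * (1 - cos t)) (at t)" for t :: real
      by (auto intro!: derivative_eq_intros simp: algebra_simps sin_squared_eq simp flip: power2_eq_square)
    show "0 < 2 * cos t * (1 - cos t)" if "0 < t" "t < x" for t :: real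
      using that assms cos_gt_zero[of t] cos_monotone_0_pi[of 0 t] by simp
  qed simp
  then show ?thesis by simp
qed

text \<open>Supplies the sign of the numerator of the derivative in
  \<open>gudermannian_gt\<close>.\<close>

lemma mult_sinh_gt:
  fixes x :: real
  assumes "0 < x"
  shows "cosh x - 1 < x * sinh x"
proof -
  have "0 < x * sinh x - cosh x + 1"
  proof (rule pos_if_zero_and_deriv_pos[OF assms])
    show "((\<lambda>t. t * sinh t - cosh t + 1) has_real_derivative t * cosh t) (at t)" for t :: real
      by (auto intro!: derivative_eq_intros)
  qed simp_all
  then show ?thesis by simp
qed

text \<open>Dividing by \<open>(cosh x)^2\<close> isolates the arctangent, whose derivative is then
  just \<open>1 / cosh t\<close>. No arctangent survives differentiation, and the whole derivative
  collapses to \<open>2 * (t * sinh t - cosh t + 1) / (cosh t)^3\<close>.\<close>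

lemma gudermannian_gt:
  fixes x :: real
  assumes "0 < x"
  shows "(cosh x - 1) * sinh x + x < (cosh x)\<^sup>2 * arctan (sinh x)"
proof -
  have "0 < arctan (sinh x) - ((cosh x - 1) * sinh x + x) / (cosh x)\<^sup>2"
  proof (rule pos_if_zero_and_deriv_pos[OF assms])
    fix t :: real
    have eq: "inverse (1 + sinh t * sinh t) = 1 / (cosh t * cosh t)"
      using cosh_square_eq[of t] by (simp add: power2_eq_square divide_inverse add.commute)
    have "((\<lambda>t. arctan (sinh t) - ((cosh t - 1) * sinh t + t) / (cosh t)\<^sup>2) has_real_derivative
        cosh t / (cosh t)\<^sup>2 - ((sinh t * sinh t + (cosh t - 1) * cosh t + 1) * (cosh t)\<^sup>2
          - ((cosh t - 1) * sinh t + t) * (2 * cosh t * sinh t)) / ((cosh t)\<^sup>2 * (cosh t)\<^sup>2)) (at t)"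
      by (auto intro!: derivative_eq_intros simp: eq algebra_simps power2_eq_square)
    also have "cosh t / (cosh t)\<^sup>2 - ((sinh t * sinh t + (cosh t - 1) * cosh t + 1) * (cosh t)\<^sup>2
          - ((cosh t - 1) * sinh t + t) * (2 * cosh t * sinh t)) / ((cosh t)\<^sup>2 * (cosh t)\<^sup>2)
        = 2 * (t * sinh t - cosh t + 1) / (cosh t) ^ 3"
    proof -
      \<comment> \<open>With \<open>c\<close> and \<open>s\<close> as plain variables the identity
        is polynomial modulo \<open>s * s = c * c - 1\<close>, which \<open>algebra\<close> can
        decide.\<close>
      define c s where "c = cosh t" and "s = sinh t"
      have "c \<noteq> 0" "s * s = c * c - 1"
        using sinh_square_eq[of t] by (simp_all add: c_def s_def power2_eq_square)
      then have num: "c * c\<^sup>2 - ((s * s + (c - 1) * c + 1) * c\<^sup>2 - ((c - 1) * s + t) * (2 * c * s))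
        = 2 * (t * s - c + 1) * c"
        by algebra
      \<comment> \<open>\<open>num\<close> turns the right side into a single fraction; the second
        occurrence of a divided difference is that fraction, whose first term \<open>c * c^2\<close>
        then cancels to \<open>c / c^2\<close>.\<close>
      have "c / c\<^sup>2 - ((s * s + (c - 1) * c + 1) * c\<^sup>2 - ((c - 1) * s + t) * (2 * c * s)) / (c\<^sup>2 * c\<^sup>2)
        = 2 * (t * s - c + 1) * c / (c\<^sup>2 * c\<^sup>2)"
        unfolding num[symmetric] using \<open>c \<noteq> 0\<close>
        by (subst (2) diff_divide_distrib) (simp add: power2_eq_square)
      also have "\<dots> = 2 * (t * s - c + 1) / c ^ 3"
        using \<open>c \<noteq> 0\<close> by (simp add: power2_eq_square power3_eq_cube)
      finally show ?thesis by (simp add: c_def s_def)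
    qed
    finally show "((\<lambda>t. arctan (sinh t) - ((cosh t - 1) * sinh t + t) / (cosh t)\<^sup>2)
        has_real_derivative 2 * (t * sinh t - cosh t + 1) / (cosh t) ^ 3) (at t)" .
    show "0 < 2 * (t * sinh t - cosh t + 1) / (cosh t) ^ 3" if "0 < t"
      using mult_sinh_gt[OF that] by simp
  qed simp
  then show ?thesis
    by (simp add: field_simps)
qed

lemma
  fixes p q :: real
  assumes "0 < p" "0 < q" "q < pi / 2" and "cos q * cosh p = 1"
  shows gudermannian_eq: "q = arctan (sinh p)"
    and sin_gudermannian: "sin q * cosh p = sinh p"
proof -
  have "(sin q * cosh p)\<^sup>2 = (cosh p)\<^sup>2 - (cos q * cosh p)\<^sup>2"
    by (simp add: power_mult_distrib sin_squared_eq algebra_simps)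
  then have "(sin q * cosh p)\<^sup>2 = (sinh p)\<^sup>2"
    using assms(4) by (simp add: sinh_square_eq)
  moreover have "0 < sin q" using assms by (simp add: sin_gt_zero)
  ultimately show sin: "sin q * cosh p = sinh p"
    using assms(1) power2_eq_imp_eq[of "sin q * cosh p" "sinh p"] by simp
  \<comment> \<open>Expand the tangent by \<open>cosh p\<close>: the numerator becomes
    \<open>sinh p\<close> and the denominator 1.\<close>
  have "tan q = sinh p / (cos q * cosh p)"
    unfolding sin[symmetric] by (subst mult_divide_mult_cancel_right) (simp_all add: tan_def)
  then have "tan q = sinh p"
    unfolding assms(4) by simp
  then show "q = arctan (sinh p)"
    using assms arctan_tan[of q] by simp
qed

text \<open>Compares two Neuman means of the same pair in opposite order, in units of half the
  smaller entry. Substituting \<open>q = arctan (sinh p)\<close> and multiplying by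
  \<open>sinh p\<close> leaves \<open>gudermannian_gt\<close>.\<close>

lemma gudermannian_compare:
  fixes p q :: real
  assumes "0 < p" "0 < q" "q < pi / 2" and "cos q * cosh p = 1"
  shows "cosh p + p / sinh p < cosh p * (cos q + q / sin q)"
proof -
  have "0 < sin q" using assms by (simp add: sin_gt_zero)
  have "cosh p * sinh p + p < sinh p + (cosh p)\<^sup>2 * q"
    using gudermannian_gt[OF assms(1)] gudermannian_eq[OF assms] by (simp add: algebra_simps)
  then have "(cosh p * sinh p + p) / sinh p < (sinh p + (cosh p)\<^sup>2 * q) / sinh p"
    using assms(1) by (simp add: divide_strict_right_mono)
  then have "cosh p + p / sinh p < 1 + (cosh p)\<^sup>2 * q / sinh p"
    using assms(1) by (simp add: add_divide_distrib)
  \<comment> \<open>Writing \<open>sinh p\<close> as \<open>sin q * cosh p\<close> cancels one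
    factor \<open>cosh p\<close>.\<close>
  also have "(cosh p)\<^sup>2 * q / sinh p = cosh p * (q / sin q)"
    using \<open>0 < sin q\<close> unfolding sin_gudermannian[OF assms, symmetric]
    by (simp add: power2_eq_square)
  finally show ?thesis
    using assms(4) by (simp add: algebra_simps)
qed

text \<open>The first argument exceeds \<open>k\<close>, so the \<open>arcosh\<close> branch applies
  and returns \<open>r\<close>; the root is \<open>k * sinh r\<close> since
  \<open>cosh^2 - 1 = sinh^2\<close>. \<open>N_mean_cos\<close> treats the \<open>arccos\<close>
  branch in the same way.\<close>

lemma N_mean_cosh:
  assumes "0 < k" "0 < r"
  shows "N_mean (k * cosh r) k = k / 2 * (cosh r + r / sinh r)"
proof -
  have "k * 1 < k * cosh r"
    using assms cosh_real_strict_mono[of 0 r] by (intro mult_strict_left_mono) simp_all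
  moreover have "sqrt ((k * cosh r)\<^sup>2 - k\<^sup>2) = sqrt ((k * sinh r)\<^sup>2)"
    by (simp add: power_mult_distrib sinh_square_eq algebra_simps)
  then have "sqrt ((k * cosh r)\<^sup>2 - k\<^sup>2) = k * sinh r"
    using assms by simp
  ultimately have SB: "SB_mean (k * cosh r) k = k * sinh r / r"
    using assms by (simp add: SB_mean_def arcosh_cosh_real)
  then show ?thesis
    using assms unfolding N_mean_def SB by (simp add: power2_eq_square distrib_left)
qed

lemma N_mean_cos:
  assumes "0 < k" "0 < q" "q < pi"
  shows "N_mean (k * cos q) k = k / 2 * (cos q + q / sin q)"
proof -
  have "0 < sin q" using assms by (simp add: sin_gt_zero)
  have "k * cos q < k * 1"
    using assms cos_monotone_0_pi[of 0 q] by (intro mult_strict_left_mono) simp_all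
  moreover have "sqrt (k\<^sup>2 - (k * cos q)\<^sup>2) = sqrt ((k * sin q)\<^sup>2)"
    by (simp add: power_mult_distrib sin_squared_eq algebra_simps)
  then have "sqrt (k\<^sup>2 - (k * cos q)\<^sup>2) = k * sin q"
    using assms \<open>0 < sin q\<close> by simp
  ultimately have SB: "SB_mean (k * cos q) k = k * sin q / q"
    using assms by (simp add: SB_mean_def arccos_cos)
  then show ?thesis
    using assms \<open>0 < sin q\<close> unfolding N_mean_def SB by (simp add: power2_eq_square distrib_left)
qed

text \<open>Scaled by \<open>k / 2\<close>, this puts the mean of \<open>N_mean_cosh\<close> above
  \<open>k\<close>; \<open>cos_plus_less_2\<close> puts that of \<open>N_mean_cos\<close> below
  \<open>k\<close>.\<close>

lemma cosh_plus_gt_2: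
  fixes x :: real
  assumes "0 < x"
  shows "2 < cosh x + x / sinh x"
  using sinh_cosh_gt[OF assms] assms by (simp add: field_simps)

lemma cos_plus_less_2:
  fixes x :: real
  assumes "0 < x" "x < pi / 2"
  shows "cos x + x / sin x < 2"
  using sin_cos_less[OF assms] sin_gt_zero[of x] assms by (simp add: field_simps)

theorem theorem1p1:
  fixes a b v p q r s :: real
  assumes "a > b" and "b > 0"
    and "v = (a - b) / (a + b)"
    and "p \<in> {0<..}" and "1 / cosh p = 1 - v\<^sup>2"
    and "q \<in> {0<..<pi / 2}" and "cos q = 1 - v\<^sup>2"
    and "r \<in> {0<..<ln (2 + sqrt 3)}" and "cosh r = 1 + v\<^sup>2"
    and "s \<in> {0<..<pi / 3}" and "1 / cos s = 1 + v\<^sup>2"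
  shows "N_AH a b = 1 / 2 * A_mean a b * (1 + 2 * p / sinh (2 * p)) \<and>
         N_HA a b = 1 / 2 * A_mean a b * (cos q + q / sin q) \<and>
         N_CA a b = 1 / 2 * A_mean a b * (cosh r + r / sinh r) \<and>
         N_AC a b = 1 / 2 * A_mean a b * (1 + 2 * s / sin (2 * s)) \<and>
         H_mean a b < N_AH a b \<and> N_AH a b < N_HA a b \<and> N_HA a b < A_mean a b \<and>
         A_mean a b < N_CA a b \<and> N_CA a b < N_AC a b \<and> N_AC a b < C_mean a b"
proof -
  define A H C where "A = A_mean a b" and "H = H_mean a b" and "C = C_mean a b"
  have "0 < p" "0 < q" "q < pi / 2" "0 < r" "0 < s" "s < pi / 2"
    using assms by auto
  then have "q < pi" "s < pi" by simp_all
  have cos_pos: "0 < cos q" "0 < cos s"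
    using \<open>0 < q\<close> \<open>q < pi / 2\<close> \<open>0 < s\<close> \<open>s < pi / 2\<close> by (simp_all add: cos_gt_zero)
  have "0 < sinh p" "0 < sin s"
    using \<open>0 < p\<close> \<open>0 < s\<close> \<open>s < pi / 2\<close> by (simp_all add: sin_gt_zero)
  have qp: "cos q * cosh p = 1"
    unfolding assms(7) assms(5)[symmetric] by simp
  have sr: "cos s * cosh r = 1"
    using cos_pos unfolding assms(9) assms(11)[symmetric] by simp
  have pos: "0 < A" "0 < H" "0 < C"
    using assms(1,2) by (simp_all add: A_def A_mean_def H_def H_mean_def C_def C_mean_def add_pos_pos)
  have ab: "b = A * (1 - v)" "a = A * (1 + v)"
    using assms(1,2) unfolding assms(3) A_def A_mean_def by (simp_all add: field_simps)
  then have "H = A * (1 - v\<^sup>2)" "C = A * (1 + v\<^sup>2)"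
    using pos(1) unfolding H_def C_def H_mean_def C_mean_def ab
    by (simp_all add: field_simps power2_eq_square)
  then have HA: "H = A * cos q" and CA: "C = A * cosh r"
    using assms(7,9) by simp_all
  \<comment> \<open>Each pair is parametrised both ways, so that either entry can serve as the unit
    \<open>k\<close>.\<close>
  then have AH: "A = H * cosh p" and AC: "A = C * cos s"
    using qp sr by (simp_all add: mult.commute mult.left_commute)

  have N_AH: "N_AH a b = H / 2 * (cosh p + p / sinh p)"
    using N_mean_cosh[OF \<open>0 < H\<close> \<open>0 < p\<close>] AH unfolding N_AH_def A_def H_def by simp
  have N_HA: "N_HA a b = A / 2 * (cos q + q / sin q)"
    using N_mean_cos[OF \<open>0 < A\<close> \<open>0 < q\<close> \<open>q < pi\<close>] HA unfolding N_HA_def A_def H_def by simp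
  have N_CA: "N_CA a b = A / 2 * (cosh r + r / sinh r)"
    using N_mean_cosh[OF \<open>0 < A\<close> \<open>0 < r\<close>] CA unfolding N_CA_def A_def C_def by simp
  have N_AC: "N_AC a b = C / 2 * (cos s + s / sin s)"
    using N_mean_cos[OF \<open>0 < C\<close> \<open>0 < s\<close> \<open>s < pi\<close>] AC unfolding N_AC_def A_def C_def by simp

  \<comment> \<open>Changing the unit from \<open>H\<close> to \<open>A = H * cosh p\<close>
    produces the doubled argument, via \<open>sinh (2 * p) = 2 * sinh p * cosh p\<close>; likewise
    for \<open>s\<close> below.\<close>
  have "N_AH a b = 1 / 2 * A * (1 + 2 * p / sinh (2 * p))"
    using \<open>0 < sinh p\<close> unfolding N_AH AH sinh_double by (simp add: field_simps)
  moreover have "N_AC a b = 1 / 2 * A * (1 + 2 * s / sin (2 * s))"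
    using \<open>0 < sin s\<close> cos_pos unfolding N_AC AC sin_double by (simp add: field_simps)
  moreover have "N_HA a b = 1 / 2 * A * (cos q + q / sin q)"
    "N_CA a b = 1 / 2 * A * (cosh r + r / sinh r)"
    using N_HA N_CA by simp_all
  moreover have "H < N_AH a b"
    using cosh_plus_gt_2[OF \<open>0 < p\<close>] \<open>0 < H\<close> unfolding N_AH by simp
  moreover have "N_AH a b < N_HA a b"
    using gudermannian_compare[OF \<open>0 < p\<close> \<open>0 < q\<close> \<open>q < pi / 2\<close> qp] \<open>0 < H\<close>
    unfolding N_AH N_HA AH by simp
  moreover have "N_HA a b < A"
    using cos_plus_less_2[OF \<open>0 < q\<close> \<open>q < pi / 2\<close>] \<open>0 < A\<close> unfolding N_HA by simp
  moreover have "A < N_CA a b"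
    using cosh_plus_gt_2[OF \<open>0 < r\<close>] \<open>0 < A\<close> unfolding N_CA by simp
  \<comment> \<open>The same comparison as for \<open>N_AH\<close> and \<open>N_HA\<close>, with
    \<open>r\<close>, \<open>s\<close> for \<open>p\<close>, \<open>q\<close> and the pair
    \<open>A\<close>, \<open>C\<close> for \<open>H\<close>, \<open>A\<close>.\<close>
  moreover have "N_CA a b < N_AC a b"
    using gudermannian_compare[OF \<open>0 < r\<close> \<open>0 < s\<close> \<open>s < pi / 2\<close> sr] \<open>0 < A\<close>
    unfolding N_CA N_AC CA by simp
  moreover have "N_AC a b < C"
    using cos_plus_less_2[OF \<open>0 < s\<close> \<open>s < pi / 2\<close>] \<open>0 < C\<close> unfolding N_AC by simp
  ultimately show ?thesis
    unfolding A_def H_def C_def by blast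
qed

end
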